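(* For every integer $n\ge 6$ there exists a boolean term order on the subsets of $[n]$ that has fewer than $n$ flippable pairs.
   Context: Write $[n]=\{1,\dots,n\}$. A boolean term order is a total order $\prec$ on the subsets of $[n]$ such that (1) $\emptyset\prec\alpha$ for all $\alpha\subseteq[n]$ with $\alpha\ne\emptyset$; (2) if $\alpha\prec\beta$ and $\gamma\cap(\alpha\cup\beta)=\emptyset$ then $\alpha\cup\gamma\prec\beta\cup\gamma$. Two subsets $\alpha\prec\beta$ are adjacent if there is no $\gamma$ with $\alpha\prec\gamma\prec\beta$. A primitive pair of $\prec$ is an adjacent pair $\alpha\prec\beta$ with $\alpha\cap\beta=\emptyset$. A flippable pair is a primitive pair $\alpha\prec\beta$ such that for every $l\subseteq[n]$ with $l\cap(\alpha\cup\beta)=\emptyset$ the pair $\alpha\cup l\prec\beta\cup l$ is adjacent. *)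

theory Defs
  imports Main
begin

text \<open>The order is the strict relation, with \<open>(\<alpha>, \<beta>) \<in> r\<close> read as \<open>\<alpha> \<prec> \<beta>\<close>. It is required to relate
  only subsets of \<open>{1..n}\<close>, so that \<^const>\<open>trans\<close> and \<^const>\<open>irrefl\<close>, which are not relativised to
  a carrier, speak about these subsets alone.\<close>

definition boolean_term_order :: "nat \<Rightarrow> nat set rel \<Rightarrow> bool" where
  "boolean_term_order n r \<longleftrightarrow>
     r \<subseteq> Pow {1..n} \<times> Pow {1..n} \<and>
     strict_linear_order_on (Pow {1..n}) r \<and>
     (\<forall>\<alpha>. \<alpha> \<subseteq> {1..n} \<and> \<alpha> \<noteq> {} \<longrightarrow> ({}, \<alpha>) \<in> r) \<and>
     (\<forall>\<alpha> \<beta> \<gamma>. \<alpha> \<subseteq> {1..n} \<and> \<beta> \<subseteq> {1..n} \<and> \<gamma> \<subseteq> {1..n} \<and>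
        (\<alpha>, \<beta>) \<in> r \<and> \<gamma> \<inter> (\<alpha> \<union> \<beta>) = {} \<longrightarrow> (\<alpha> \<union> \<gamma>, \<beta> \<union> \<gamma>) \<in> r)"

definition adjacent_pair :: "nat \<Rightarrow> nat set rel \<Rightarrow> nat set \<Rightarrow> nat set \<Rightarrow> bool" where
  "adjacent_pair n r \<alpha> \<beta> \<longleftrightarrow>
     \<alpha> \<subseteq> {1..n} \<and> \<beta> \<subseteq> {1..n} \<and> (\<alpha>, \<beta>) \<in> r \<and>
     \<not> (\<exists>\<gamma>. \<gamma> \<subseteq> {1..n} \<and> (\<alpha>, \<gamma>) \<in> r \<and> (\<gamma>, \<beta>) \<in> r)"

definition primitive_pair :: "nat \<Rightarrow> nat set rel \<Rightarrow> nat set \<Rightarrow> nat set \<Rightarrow> bool" where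
  "primitive_pair n r \<alpha> \<beta> \<longleftrightarrow> adjacent_pair n r \<alpha> \<beta> \<and> \<alpha> \<inter> \<beta> = {}"

definition flippable_pair :: "nat \<Rightarrow> nat set rel \<Rightarrow> nat set \<Rightarrow> nat set \<Rightarrow> bool" where
  "flippable_pair n r \<alpha> \<beta> \<longleftrightarrow>
     primitive_pair n r \<alpha> \<beta> \<and>
     (\<forall>l. l \<subseteq> {1..n} \<and> l \<inter> (\<alpha> \<union> \<beta>) = {} \<longrightarrow> adjacent_pair n r (\<alpha> \<union> l) (\<beta> \<union> l))"

end

theory Submission
  imports Defs
begin

text \<open>Adding a new largest element that dominates all others (so the new order lists the old one,
  then the old one with \<open>n + 1\<close> adjoined) creates only the flippable pair
  \<open>{1..n} \<prec> {n + 1}\<close>, so by induction it suffices to treat \<open>n = 6\<close>. An order on the subsets of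
  \<open>{1..6}\<close> with five flippable pairs was found by a computer search through the orders reachable
  by flips from the lexicographic one. For coherent orders, the ones induced by a weight vector,
  the number of flippable pairs is always at least \<open>n\<close>.\<close>

section \<open>Strict orders read off from lists\<close>

fun before :: "'a list \<Rightarrow> 'a rel" where
  "before [] = {}"
| "before (x # xs) = {x} \<times> set xs \<union> before xs"

lemma before_subset: "before xs \<subseteq> set xs \<times> set xs"
  by (induction xs) auto

lemma trans_before: "distinct xs \<Longrightarrow> trans (before xs)"
proof (induction xs)
  case (Cons a xs)
  then show ?case
    using before_subset [of xs] unfolding trans_def before.simps distinct.simps by blast
qed simp

lemma irrefl_before: "distinct xs \<Longrightarrow> irrefl (before xs)"
proof (induction xs)
  case (Cons a xs)
  then show ?case
    using before_subset [of xs] by (auto simp: irrefl_def)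
qed (simp add: irrefl_def)

lemma total_on_before: "total_on (set xs) (before xs)"
  by (induction xs) (auto simp: total_on_def)

lemma before_filter: "before (filter P xs) = {(x, y) \<in> before xs. P x \<and> P y}"
proof (induction xs)
  case (Cons a xs)
  then show ?case
    using before_subset [of xs] by (cases "P a") auto
qed simp

lemma before_map: "before (map f xs) = map_prod f f ` before xs"
  by (induction xs) auto

text \<open>Reduces adjacency to a lookup among neighbouring entries, which can be evaluated. A pair
  not already related in the tail starts at the head, and then the second entry would lie between
  unless it is \<open>y\<close>.\<close>

lemma consecutive_if_no_between:
  assumes "(x, y) \<in> before xs" "\<And>z. (x, z) \<in> before xs \<Longrightarrow> (z, y) \<notin> before xs"
  shows "(x, y) \<in> set (zip xs (tl xs))"
  using assms
proof (induction xs rule: induct_list012)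
  case (3 a b xs)
  show ?case
  proof (cases "(x, y) \<in> before (b # xs)")
    case True
    with 3 show ?thesis by auto
  next
    case False
    with "3.prems" show ?thesis by auto
  qed
qed auto

text \<open>Translation by a finite set is a succession of insertions of single elements. Insertion
  of \<open>g\<close> preserves the order because the sets containing \<open>g\<close> are listed in
  the same sequence as those from which they arise. Condition (2) thus becomes one list equation for
  each \<open>g\<close>.\<close>

lemma boolean_term_order_before:
  assumes xs: "distinct xs" "set xs = Pow {1..n}" "hd xs = {}"
    and insert: "\<And>g. g \<in> {1..n} \<Longrightarrow>
      map (insert g) (filter (\<lambda>a. g \<notin> a) xs) = filter (\<lambda>a. g \<in> a) xs"
  shows "boolean_term_order n (before xs)"
proof -
  have least: "({}, \<alpha>) \<in> before xs" if "\<alpha> \<subseteq> {1..n}" "\<alpha> \<noteq> {}" for \<alpha>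
    using xs that by (cases xs) auto
  have single: "(insert g \<alpha>, insert g \<beta>) \<in> before xs"
    if "(\<alpha>, \<beta>) \<in> before xs" "g \<in> {1..n}" "g \<notin> \<alpha>" "g \<notin> \<beta>" for \<alpha> \<beta> g
  proof -
    have "(\<alpha>, \<beta>) \<in> before (filter (\<lambda>a. g \<notin> a) xs)"
      using that by (simp add: before_filter)
    then have "(insert g \<alpha>, insert g \<beta>) \<in> before (filter (\<lambda>a. g \<in> a) xs)"
      unfolding insert [OF \<open>g \<in> {1..n}\<close>, symmetric] before_map by force
    then show ?thesis
      by (simp add: before_filter)
  qed
  have union: "(\<alpha> \<union> \<gamma>, \<beta> \<union> \<gamma>) \<in> before xs"
    if "finite \<gamma>" "(\<alpha>, \<beta>) \<in> before xs" "\<gamma> \<subseteq> {1..n}" "\<gamma> \<inter> (\<alpha> \<union> \<beta>) = {}" for \<alpha> \<beta> \<gamma>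
    using that
  proof (induction \<gamma>)
    case (insert g \<gamma>)
    then have "(insert g (\<alpha> \<union> \<gamma>), insert g (\<beta> \<union> \<gamma>)) \<in> before xs"
      by (intro single) auto
    then show ?case
      by simp
  qed simp
  show ?thesis
    unfolding boolean_term_order_def strict_linear_order_on_def
  proof (intro conjI allI impI)
    show "before xs \<subseteq> Pow {1..n} \<times> Pow {1..n}"
      using before_subset [of xs] by (simp add: xs(2))
    show "total_on (Pow {1..n}) (before xs)"
      using total_on_before [of xs] by (simp add: xs(2))
    show "({}, \<alpha>) \<in> before xs" if "\<alpha> \<subseteq> {1..n} \<and> \<alpha> \<noteq> {}" for \<alpha>
      using that least by blast
    show "(\<alpha> \<union> \<gamma>, \<beta> \<union> \<gamma>) \<in> before xs"
      if "\<alpha> \<subseteq> {1..n} \<and> \<beta> \<subseteq> {1..n} \<and> \<gamma> \<subseteq> {1..n} \<and> (\<alpha>, \<beta>) \<in> before xs \<and> \<gamma> \<inter> (\<alpha> \<union> \<beta>) = {}"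
      for \<alpha> \<beta> \<gamma>
      using that by (intro union) (auto intro: finite_subset)
  qed (simp_all add: trans_before irrefl_before xs(1))
qed

text \<open>The right-hand side is computable from the list, and an inclusion suffices to bound the
  number of flippable pairs from above.\<close>

lemma flippable_pair_before_subset:
  assumes "set xs = Pow {1..n}"
  shows "{(\<alpha>, \<beta>). flippable_pair n (before xs) \<alpha> \<beta>} \<subseteq>
    {(\<alpha>, \<beta>) \<in> set (zip xs (tl xs)). \<alpha> \<inter> \<beta> = {} \<and>
      (\<forall>l \<in> Pow ({1..n} - (\<alpha> \<union> \<beta>)). (\<alpha> \<union> l, \<beta> \<union> l) \<in> set (zip xs (tl xs)))}"
proof -
  have consecutive: "(\<alpha>, \<beta>) \<in> set (zip xs (tl xs))"
    if "adjacent_pair n (before xs) \<alpha> \<beta>" for \<alpha> \<beta>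
  proof (rule consecutive_if_no_between)
    show "(\<alpha>, \<beta>) \<in> before xs"
      using that by (simp add: adjacent_pair_def)
    show "(\<gamma>, \<beta>) \<notin> before xs" if "(\<alpha>, \<gamma>) \<in> before xs" for \<gamma>
    proof -
      have "\<gamma> \<subseteq> {1..n}"
        using that before_subset [of xs] assms by blast
      with that \<open>adjacent_pair n (before xs) \<alpha> \<beta>\<close> show ?thesis
        unfolding adjacent_pair_def by blast
    qed
  qed
  show ?thesis
    unfolding flippable_pair_def primitive_pair_def
    by (intro subsetI, clarify) (intro conjI ballI CollectI case_prodI consecutive; blast)
qed

section \<open>The order on the subsets of \<open>{1..6}\<close>\<close>

definition order6 :: "nat set list" where
  "order6 =
   [{}, {1}, {2}, {3}, {1, 2}, {4}, {1, 3}, {2, 3}, {1, 4}, {5}, {2, 4}, {1, 2, 3}, {1, 5},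
    {3, 4}, {1, 2, 4}, {1, 3, 4}, {2, 5}, {3, 5}, {1, 2, 5}, {2, 3, 4}, {4, 5}, {1, 3, 5},
    {1, 2, 3, 4}, {2, 3, 5}, {6}, {1, 4, 5}, {2, 4, 5}, {1, 2, 3, 5}, {3, 4, 5}, {1, 6},
    {2, 6}, {3, 6}, {1, 2, 4, 5}, {1, 3, 4, 5}, {2, 3, 4, 5}, {1, 2, 6}, {4, 6}, {1, 3, 6},
    {2, 3, 6}, {1, 2, 3, 4, 5}, {1, 4, 6}, {5, 6}, {2, 4, 6}, {1, 2, 3, 6}, {1, 5, 6},
    {3, 4, 6}, {1, 2, 4, 6}, {1, 3, 4, 6}, {2, 5, 6}, {3, 5, 6}, {1, 2, 5, 6}, {2, 3, 4, 6},
    {4, 5, 6}, {1, 3, 5, 6}, {1, 2, 3, 4, 6}, {2, 3, 5, 6}, {1, 4, 5, 6}, {2, 4, 5, 6},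
    {1, 2, 3, 5, 6}, {3, 4, 5, 6}, {1, 2, 4, 5, 6}, {1, 3, 4, 5, 6}, {2, 3, 4, 5, 6},
    {1, 2, 3, 4, 5, 6}]"

lemma set_order6: "set order6 = Pow {1..6}"
  by code_simp

text \<open>A count replaces the pairwise comparison: 64 entries exhaust \<open>2 ^ 6\<close>
  subsets, so none can repeat.\<close>

lemma distinct_order6: "distinct order6"
proof (rule card_distinct)
  have "length order6 = 2 ^ 6"
    by (simp add: order6_def)
  then show "card (set order6) = length order6"
    by (simp add: set_order6 card_Pow)
qed

lemma boolean_term_order_order6: "boolean_term_order 6 (before order6)"
proof (rule boolean_term_order_before)
  have "\<forall>g \<in> {1..6}. map (insert g) (filter (\<lambda>a. g \<notin> a) order6) = filter (\<lambda>a. g \<in> a) order6"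
    by code_simp
  then show "map (insert g) (filter (\<lambda>a. g \<notin> a) order6) = filter (\<lambda>a. g \<in> a) order6"
    if "g \<in> {1..6}" for g
    using that by blast
qed (simp_all add: distinct_order6 set_order6, simp add: order6_def)

lemma card_flippable_pair_order6:
  "card {(\<alpha>, \<beta>). flippable_pair 6 (before order6) \<alpha> \<beta>} < 6"
proof -
  \<comment> \<open>Evaluation leaves five pairs: \<open>{4}\<close> and \<open>{1, 3}\<close>,
    \<open>{1, 5}\<close> and \<open>{3, 4}\<close>, \<open>{1, 3, 4}\<close> and
    \<open>{2, 5}\<close>, \<open>{3, 4, 5}\<close> and \<open>{1, 6}\<close>, \<open>{3, 6}\<close>
    and \<open>{1, 2, 4, 5}\<close>. The last is complementary, so only \<open>l = {}\<close> has to
    be tested for it.\<close>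
  define F where "F = filter (\<lambda>(\<alpha>, \<beta>). \<alpha> \<inter> \<beta> = {} \<and>
    (\<forall>l \<in> Pow ({1..6} - (\<alpha> \<union> \<beta>)). (\<alpha> \<union> l, \<beta> \<union> l) \<in> set (zip order6 (tl order6))))
    (zip order6 (tl order6))"
  have "{(\<alpha>, \<beta>). flippable_pair 6 (before order6) \<alpha> \<beta>} \<subseteq> set F"
    using flippable_pair_before_subset [OF set_order6] by (auto simp: F_def)
  then have "card {(\<alpha>, \<beta>). flippable_pair 6 (before order6) \<alpha> \<beta>} \<le> length F"
    by (meson List.finite_set card_length card_mono order_trans)
  also have "length F < 6"
    unfolding F_def by code_simp
  finally show ?thesis .
qed

section \<open>Adjoining a dominant element\<close>

text \<open>The subset conditions keep the first alternative, which does not mention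
  \<open>r\<close>, inside the carrier.\<close>

definition extend_order :: "nat \<Rightarrow> nat set rel \<Rightarrow> nat set rel" where
  "extend_order n r = {(\<alpha>, \<beta>). \<alpha> \<subseteq> {1..Suc n} \<and> \<beta> \<subseteq> {1..Suc n} \<and>
     (Suc n \<notin> \<alpha> \<and> Suc n \<in> \<beta> \<or>
      (Suc n \<in> \<alpha> \<longleftrightarrow> Suc n \<in> \<beta>) \<and> (\<alpha> - {Suc n}, \<beta> - {Suc n}) \<in> r)}"

text \<open>For condition (2), a set \<gamma> containing \<open>Suc n\<close> can be added only to a
  pair in the lower half, which it moves to the upper half. A pair that crosses the halves still
  crosses after the addition. All else is inherited from \<open>r\<close>.\<close>

lemma boolean_term_order_extend_order:
  assumes "boolean_term_order n r"
  shows "boolean_term_order (Suc n) (extend_order n r)"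
proof -
  have r: "trans r" "irrefl r" "total_on (Pow {1..n}) r"
    and least: "\<And>\<alpha>. \<alpha> \<subseteq> {1..n} \<Longrightarrow> \<alpha> \<noteq> {} \<Longrightarrow> ({}, \<alpha>) \<in> r"
    and union: "\<And>\<alpha> \<beta> \<gamma>. \<lbrakk>\<alpha> \<subseteq> {1..n}; \<beta> \<subseteq> {1..n}; \<gamma> \<subseteq> {1..n}; (\<alpha>, \<beta>) \<in> r;
      \<gamma> \<inter> (\<alpha> \<union> \<beta>) = {}\<rbrakk> \<Longrightarrow> (\<alpha> \<union> \<gamma>, \<beta> \<union> \<gamma>) \<in> r"
    using assms by (auto simp: boolean_term_order_def strict_linear_order_on_def)
  have restrict: "\<alpha> - {Suc n} \<subseteq> {1..n}" if "\<alpha> \<subseteq> {1..Suc n}" for \<alpha>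
    using that by (auto simp: subset_iff le_Suc_eq)
  show ?thesis
    unfolding boolean_term_order_def strict_linear_order_on_def
  proof (intro conjI allI impI)
    show "extend_order n r \<subseteq> Pow {1..Suc n} \<times> Pow {1..Suc n}"
      by (auto simp: extend_order_def)
    show "trans (extend_order n r)"
    proof (rule transI)
      fix \<alpha> \<beta> \<gamma> assume "(\<alpha>, \<beta>) \<in> extend_order n r" "(\<beta>, \<gamma>) \<in> extend_order n r"
      then show "(\<alpha>, \<gamma>) \<in> extend_order n r"
        using transD [OF r(1), of "\<alpha> - {Suc n}" "\<beta> - {Suc n}" "\<gamma> - {Suc n}"]
        unfolding extend_order_def by blast
    qed
    show "irrefl (extend_order n r)"
      using r(2) by (auto simp: irrefl_def extend_order_def)
    show "total_on (Pow {1..Suc n}) (extend_order n r)"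
    proof (rule total_onI)
      fix \<alpha> \<beta> assume ab: "\<alpha> \<in> Pow {1..Suc n}" "\<beta> \<in> Pow {1..Suc n}" "\<alpha> \<noteq> \<beta>"
      show "(\<alpha>, \<beta>) \<in> extend_order n r \<or> (\<beta>, \<alpha>) \<in> extend_order n r"
      proof (cases "Suc n \<in> \<alpha> \<longleftrightarrow> Suc n \<in> \<beta>")
        case True
        with ab have "\<alpha> - {Suc n} \<noteq> \<beta> - {Suc n}"
          by blast
        then have "(\<alpha> - {Suc n}, \<beta> - {Suc n}) \<in> r \<or> (\<beta> - {Suc n}, \<alpha> - {Suc n}) \<in> r"
          using r(3) restrict ab by (simp add: total_on_def)
        with True ab show ?thesis
          by (auto simp: extend_order_def)
      qed (use ab in \<open>auto simp: extend_order_def\<close>)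
    qed
    show "({}, \<alpha>) \<in> extend_order n r" if "\<alpha> \<subseteq> {1..Suc n} \<and> \<alpha> \<noteq> {}" for \<alpha>
      using that restrict [of \<alpha>] least [of \<alpha>] by (cases "Suc n \<in> \<alpha>") (auto simp: extend_order_def)
    show "(\<alpha> \<union> \<gamma>, \<beta> \<union> \<gamma>) \<in> extend_order n r"
      if "\<alpha> \<subseteq> {1..Suc n} \<and> \<beta> \<subseteq> {1..Suc n} \<and> \<gamma> \<subseteq> {1..Suc n} \<and>
        (\<alpha>, \<beta>) \<in> extend_order n r \<and> \<gamma> \<inter> (\<alpha> \<union> \<beta>) = {}" for \<alpha> \<beta> \<gamma>
      using that restrict [of \<alpha>] restrict [of \<beta>] restrict [of \<gamma>]
        union [of "\<alpha> - {Suc n}" "\<beta> - {Suc n}" "\<gamma> - {Suc n}"]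
      unfolding extend_order_def mem_Collect_eq prod.case Un_Diff by blast
  qed
qed

text \<open>On the lower half the extended order agrees with \<open>r\<close>, so a set between the
  two for \<open>r\<close> would also be between them for the extension.\<close>

lemma adjacent_pair_extend_orderD:
  assumes "adjacent_pair (Suc n) (extend_order n r) \<alpha> \<beta>" "\<alpha> \<subseteq> {1..n}" "\<beta> \<subseteq> {1..n}"
  shows "adjacent_pair n r \<alpha> \<beta>"
proof -
  have new: "Suc n \<notin> \<gamma>" if "\<gamma> \<subseteq> {1..n}" for \<gamma>
    using that by auto
  have sub: "\<gamma> \<subseteq> {1..Suc n}" if "\<gamma> \<subseteq> {1..n}" for \<gamma>
    using that by auto
  have "(\<gamma>, \<delta>) \<in> extend_order n r \<longleftrightarrow> (\<gamma>, \<delta>) \<in> r" if "\<gamma> \<subseteq> {1..n}" "\<delta> \<subseteq> {1..n}" for \<gamma> \<delta>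
    using new [OF that(1)] new [OF that(2)] sub [OF that(1)] sub [OF that(2)]
    by (simp add: extend_order_def)
  with assms sub show ?thesis
    unfolding adjacent_pair_def by metis
qed

text \<open>A pair crossing the halves is adjacent only at the seam, where the largest set without
  \<open>Suc n\<close> meets the smallest set with it. A pair inside the upper half is not disjoint.
  A pair inside the lower half passes its tests for all \<open>l\<close> within
  \<open>{1..n}\<close>, hence is flippable for \<open>r\<close>.\<close>

lemma flippable_pair_extend_orderD:
  assumes r: "boolean_term_order n r"
    and flip: "flippable_pair (Suc n) (extend_order n r) \<alpha> \<beta>"
  shows "flippable_pair n r \<alpha> \<beta> \<or> (\<alpha>, \<beta>) = ({1..n}, {Suc n})"
proof -
  have sub: "\<alpha> \<subseteq> {1..Suc n}" "\<beta> \<subseteq> {1..Suc n}" and disjoint: "\<alpha> \<inter> \<beta> = {}"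
    and less: "(\<alpha>, \<beta>) \<in> extend_order n r"
    and between: "\<And>\<gamma>. \<lbrakk>\<gamma> \<subseteq> {1..Suc n}; (\<alpha>, \<gamma>) \<in> extend_order n r\<rbrakk> \<Longrightarrow> (\<gamma>, \<beta>) \<notin> extend_order n r"
    and adjacent: "\<And>l. \<lbrakk>l \<subseteq> {1..Suc n}; l \<inter> (\<alpha> \<union> \<beta>) = {}\<rbrakk> \<Longrightarrow>
      adjacent_pair (Suc n) (extend_order n r) (\<alpha> \<union> l) (\<beta> \<union> l)"
    using flip by (auto simp: flippable_pair_def primitive_pair_def adjacent_pair_def)
  have least: "\<And>\<alpha>. \<alpha> \<subseteq> {1..n} \<Longrightarrow> \<alpha> \<noteq> {} \<Longrightarrow> ({}, \<alpha>) \<in> r"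
    and union: "\<And>\<alpha> \<beta> \<gamma>. \<lbrakk>\<alpha> \<subseteq> {1..n}; \<beta> \<subseteq> {1..n}; \<gamma> \<subseteq> {1..n}; (\<alpha>, \<beta>) \<in> r;
      \<gamma> \<inter> (\<alpha> \<union> \<beta>) = {}\<rbrakk> \<Longrightarrow> (\<alpha> \<union> \<gamma>, \<beta> \<union> \<gamma>) \<in> r"
    using r by (auto simp: boolean_term_order_def)
  have restrict: "\<gamma> - {Suc n} \<subseteq> {1..n}" if "\<gamma> \<subseteq> {1..Suc n}" for \<gamma>
    using that by (auto simp: subset_iff le_Suc_eq)
  \<comment> \<open>If \<alpha> contained \<open>Suc n\<close>, the larger set \<beta> would contain
    it too, against disjointness.\<close>
  have a: "Suc n \<notin> \<alpha>" "\<alpha> \<subseteq> {1..n}"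
    using less disjoint restrict [OF sub(1)] by (auto simp: extend_order_def)
  show ?thesis
  proof (cases "Suc n \<in> \<beta>")
    case True
    have "\<beta> = {Suc n}"
    proof (rule ccontr)
      assume "\<beta> \<noteq> {Suc n}"
      with True have "({}, \<beta> - {Suc n}) \<in> r"
        by (intro least restrict sub) auto
      with True sub a between [of "{Suc n}"] show False
        by (auto simp: extend_order_def)
    qed
    moreover have "\<alpha> = {1..n}"
    proof (rule ccontr)
      assume "\<alpha> \<noteq> {1..n}"
      \<comment> \<open>Translating the comparison of \<open>{}\<close> with the complement of
        \<alpha> by \<alpha> itself puts \<open>{1..n}\<close> above \<alpha>, hence strictly
        between \<alpha> and \<beta>.\<close>
      with a have "({} \<union> \<alpha>, ({1..n} - \<alpha>) \<union> \<alpha>) \<in> r"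
        by (intro union least) auto
      moreover have "({1..n} - \<alpha>) \<union> \<alpha> = {1..n}"
        using a by blast
      ultimately show False
        using True sub a between [of "{1..n}"] by (auto simp: extend_order_def)
    qed
    ultimately show ?thesis
      by simp
  next
    case False
    then have b: "\<beta> \<subseteq> {1..n}"
      using restrict [OF sub(2)] by simp
    have adj: "adjacent_pair n r (\<alpha> \<union> l) (\<beta> \<union> l)" if "l \<subseteq> {1..n}" "l \<inter> (\<alpha> \<union> \<beta>) = {}" for l
      by (rule adjacent_pair_extend_orderD [OF adjacent]) (use that a b in auto)
    from adj [of "{}"] adj disjoint show ?thesis
      by (simp add: flippable_pair_def primitive_pair_def)
  qed
qed

text \<open>Ensures that \<open>card\<close> really counts these pairs instead of taking its default
  value 0 on infinite sets.\<close>

lemma finite_flippable_pair: "finite {(\<alpha>, \<beta>). flippable_pair n r \<alpha> \<beta>}"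
  by (rule finite_subset [of _ "Pow {1..n} \<times> Pow {1..n}"])
    (auto simp: flippable_pair_def primitive_pair_def adjacent_pair_def)

text \<open>Both the ground set and the bound grow by one, so having fewer than \<open>n\<close>
  flippable pairs passes to \<open>Suc n\<close>.\<close>

lemma card_flippable_pair_extend_order_le:
  assumes "boolean_term_order n r"
  shows "card {(\<alpha>, \<beta>). flippable_pair (Suc n) (extend_order n r) \<alpha> \<beta>} \<le>
    Suc (card {(\<alpha>, \<beta>). flippable_pair n r \<alpha> \<beta>})"
proof -
  have "card {(\<alpha>, \<beta>). flippable_pair (Suc n) (extend_order n r) \<alpha> \<beta>} \<le>
    card (insert ({1..n}, {Suc n}) {(\<alpha>, \<beta>). flippable_pair n r \<alpha> \<beta>})"
    using flippable_pair_extend_orderD [OF assms]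
    by (intro card_mono) (auto simp: finite_flippable_pair)
  also have "\<dots> \<le> Suc (card {(\<alpha>, \<beta>). flippable_pair n r \<alpha> \<beta>})"
    by (rule card_insert_le_m1) simp_all
  finally show ?thesis .
qed

theorem theorem4p4:
  fixes n :: nat
  assumes "n \<ge> 6"
  shows "\<exists>r. boolean_term_order n r \<and> card {(\<alpha>, \<beta>). flippable_pair n r \<alpha> \<beta>} < n"
  using assms
proof (induction n rule: dec_induct)
  case base
  show ?case
    using boolean_term_order_order6 card_flippable_pair_order6 by blast
next
  case (step n)
  then obtain r where r: "boolean_term_order n r"
    "card {(\<alpha>, \<beta>). flippable_pair n r \<alpha> \<beta>} < n"
    by blast
  have "card {(\<alpha>, \<beta>). flippable_pair (Suc n) (extend_order n r) \<alpha> \<beta>} < Suc n"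
    using card_flippable_pair_extend_order_le [OF r(1)] r(2) by linarith
  with boolean_term_order_extend_order [OF r(1)] show ?case
    by blast
qed

end
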